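(* Let $p\ge 2$, let $n\ge 1$, and let $\xi(1),\dots,\xi(n)$ be (centered, integrable) martingale differences relative to a filtration $\{F(i)\}$ such that $\xi(i)\in L(p)$ (i.e. $|\xi(i)|_p<\infty$) for all $i$. Then for every $x\ge 1$, $$Q_n(x)\le x^{-p}\cdot (p-1)^p\cdot n^{-p/2}\cdot\left\{\,n^{-1}\sum_{i=1}^n|\xi(i)|_p^2\right\}^{p/2}.$$
   Context: Let $(\Omega,F,\mathbf P)$ be a probability space with a filtration $F(0)=\{\emptyset,\Omega\}$, $F(i)\subset F(i+1)\subset F$. Random variables $\xi(i)$ are martingale differences relative to $\{F(i)\}$ if $\mathbf E|\xi(i)|<\infty$, $\mathbf E\,\xi(i)=0$, $\xi(i)$ is $F(i)$-measurable, and $\mathbf E[\xi(i)\mid F(k)]=0$ a.s. for all $k=0,1,\dots,i-1$. Put $S(n)=\sum_{i=1}^n\xi(i)$ and $Q_n(x)=\mathbf P(S(n)/n>x)$ for $x>0$. For a random variable $\eta$, $|\eta|_p=[\mathbf E|\eta|^p]^{1/p}$. *)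

theory Defs
  imports "HOL-Probability.Probability"
begin

text \<open>A discrete-time filtration of \<^term>\<open>M\<close>, starting at the trivial sigma-algebra. The members are
  measure spaces of which only \<^const>\<open>space\<close> and \<^const>\<open>sets\<close> matter.\<close>

definition filtration_of :: "'a measure \<Rightarrow> (nat \<Rightarrow> 'a measure) \<Rightarrow> bool" where
  "filtration_of M F \<longleftrightarrow>
     filtration (space M) F \<and>
     (\<forall>i. subalgebra M (F i)) \<and>
     sets (F 0) = {{}, space M}"

text \<open>Indices run from 1 to \<^term>\<open>n\<close>; the value \<^term>\<open>\<xi> 0\<close> is irrelevant.\<close>

definition martingale_differences ::
    "'a measure \<Rightarrow> (nat \<Rightarrow> 'a measure) \<Rightarrow> nat \<Rightarrow> (nat \<Rightarrow> 'a \<Rightarrow> real) \<Rightarrow> bool" where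
  "martingale_differences M F n \<xi> \<longleftrightarrow>
     (\<forall>i\<in>{1..n}.
        integrable M (\<xi> i) \<and>
        (\<integral>\<omega>. \<xi> i \<omega> \<partial>M) = 0 \<and>
        \<xi> i \<in> borel_measurable (F i) \<and>
        (\<forall>k<i. AE \<omega> in M. real_cond_exp M (F k) (\<xi> i) \<omega> = 0))"

definition in_Lp :: "'a measure \<Rightarrow> real \<Rightarrow> ('a \<Rightarrow> real) \<Rightarrow> bool" where
  "in_Lp M p \<eta> \<longleftrightarrow>
     \<eta> \<in> borel_measurable M \<and> integrable M (\<lambda>\<omega>. \<bar>\<eta> \<omega>\<bar> powr p)"

text \<open>Only meaningful for \<^term>\<open>p > 0\<close> and \<^term>\<open>in_Lp M p \<eta>\<close>: the Bochner integral of a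
  non-integrable function is 0, not infinity.\<close>

definition Lp_norm :: "'a measure \<Rightarrow> real \<Rightarrow> ('a \<Rightarrow> real) \<Rightarrow> real" where
  "Lp_norm M p \<eta> = (\<integral>\<omega>. \<bar>\<eta> \<omega>\<bar> powr p \<partial>M) powr (1 / p)"

definition partial_sum :: "(nat \<Rightarrow> 'a \<Rightarrow> real) \<Rightarrow> nat \<Rightarrow> 'a \<Rightarrow> real" where
  "partial_sum \<xi> n \<omega> = (\<Sum>i=1..n. \<xi> i \<omega>)"

definition tail_prob :: "'a measure \<Rightarrow> (nat \<Rightarrow> 'a \<Rightarrow> real) \<Rightarrow> nat \<Rightarrow> real \<Rightarrow> real" where
  "tail_prob M \<xi> n x = measure M {\<omega> \<in> space M. partial_sum \<xi> n \<omega> / real n > x}"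

end

theory Submission
  imports Defs
begin

text \<open>The pointwise inequality
  \<open>|s + x|^p \<le> p sgn(s) |s|^(p-1) x + (s^2 + (p-1)^2 x^2)^(p/2)\<close>
  is sharp enough to be integrated directly: for martingale increments \<open>x\<close> the linear term has mean zero,
  and Minkowski's inequality in \<open>L(p/2)\<close> bounds the rest, so
  \<open>|S + X|_p^2 \<le> |S|_p^2 + (p-1)^2 |X|_p^2\<close>. Iterating and applying Markov's inequality to
  \<open>|S(n)|^p\<close> gives the tail bound.\<close>

section \<open>Scalar inequalities for real powers\<close>

lemma power2_powr_half:
  fixes a q :: real
  shows "(a\<^sup>2) powr (q / 2) = \<bar>a\<bar> powr q"
proof -
  have "(a\<^sup>2) powr (q / 2) = (\<bar>a\<bar> powr 2) powr (q / 2)"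
    by simp
  then show ?thesis
    unfolding powr_powr by simp
qed

text \<open>Weighted AM-GM for \<open>t powr r\<close> and 1 with weights \<open>1 / r\<close> and
  \<open>1 - 1 / r\<close>, solved for \<open>t powr r\<close>.\<close>

lemma powr_Bernoulli:
  fixes r t :: real
  assumes "r \<ge> 1" "t > 0"
  shows "1 + r * (t - 1) \<le> t powr r"
proof -
  have "(t powr r) powr (1 / r) * 1 powr (1 - 1 / r) \<le> 1 / r * t powr r + (1 - 1 / r) * 1"
    using assms by (intro Youngs_inequality_0) auto
  then have "t \<le> 1 / r * t powr r + (1 - 1 / r)"
    using assms by (simp add: powr_powr)
  then have "r * t \<le> r * (1 / r * t powr r + (1 - 1 / r))"
    using assms by (intro mult_left_mono) auto
  then show ?thesis
    using assms by (simp add: algebra_simps)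
qed

text \<open>With \<open>r = p - 1\<close> this is the derivative comparison behind
  \<open>one_plus_powr_taylor_bound\<close>. A tangent-line estimate yields one factor
  \<open>r\<close>; Cauchy-Schwarz, which replaces \<open>1 + y\<close> by the square root of
  \<open>1 + r\<^sup>2 * y\<^sup>2\<close>, costs at most the second.\<close>

lemma one_plus_powr_growth:
  fixes r y :: real
  assumes "r \<ge> 1" "y \<ge> 0"
  shows "(1 + y) powr r - 1 \<le> r\<^sup>2 * y * (1 + r\<^sup>2 * y\<^sup>2) powr ((r - 1) / 2)"
proof -
  have r: "r > 0" using assms by simp
  \<comment> \<open>Bernoulli at \<open>1 / (1 + y)\<close>, multiplied by
    \<open>(1 + y) powr r\<close> below, is the tangent-line bound at the right end of the interval
    from 1 to \<open>1 + y\<close>.\<close>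
  have "1 + r * (1 / (1 + y) - 1) \<le> (1 / (1 + y)) powr r"
    using assms by (intro powr_Bernoulli) auto
  then have "(1 - r * y / (1 + y)) * (1 + y) powr r \<le> (1 / (1 + y)) powr r * (1 + y) powr r"
    using assms by (intro mult_right_mono) (auto simp: field_simps)
  then have "(1 + y) powr r - 1 \<le> r * y * ((1 + y) powr r / (1 + y))"
    using assms by (simp add: powr_divide algebra_simps)
  then have tangent: "(1 + y) powr r - 1 \<le> r * y * (1 + y) powr (r - 1)"
    using assms by (simp add: powr_diff)
  \<comment> \<open>Cauchy--Schwarz for \<open>1 + y = 1 * 1 + (1 / r) * (r * y)\<close>\<close>
  have "0 \<le> (r * y - 1 / r)\<^sup>2" by simp
  then have CS: "(1 + y)\<^sup>2 \<le> (1 + 1 / r\<^sup>2) * (1 + r\<^sup>2 * y\<^sup>2)"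
    using r by (simp add: field_simps power2_eq_square)
  have "(1 + y) powr (r - 1) = ((1 + y)\<^sup>2) powr ((r - 1) / 2)"
    using assms by (simp add: power2_powr_half)
  also have "\<dots> \<le> ((1 + 1 / r\<^sup>2) * (1 + r\<^sup>2 * y\<^sup>2)) powr ((r - 1) / 2)"
    using assms CS by (intro powr_mono2) auto
  also have "\<dots> = (1 + 1 / r\<^sup>2) powr ((r - 1) / 2) * (1 + r\<^sup>2 * y\<^sup>2) powr ((r - 1) / 2)"
    by (simp add: powr_mult)
  \<comment> \<open>The logarithm of the Cauchy-Schwarz loss is at most
    \<open>(r - 1) / (2 * r\<^sup>2)\<close>, hence at most \<open>1 - 1 / r\<close>, hence at most
    \<open>ln r\<close>.\<close>
  also have "\<dots> \<le> r * (1 + r\<^sup>2 * y\<^sup>2) powr ((r - 1) / 2)"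
  proof (intro mult_right_mono)
    have "(1 + 1 / r\<^sup>2) powr ((r - 1) / 2) = exp ((r - 1) / 2 * ln (1 + 1 / r\<^sup>2))"
      using r by (simp add: powr_def add_pos_pos less_imp_neq[symmetric])
    also have "\<dots> \<le> exp ((r - 1) / 2 * (1 / r\<^sup>2))"
      unfolding exp_le_cancel_iff using assms by (intro mult_left_mono ln_add_one_self_le_self) auto
    also have "\<dots> \<le> exp (ln r)"
    proof -
      have "1 / r\<^sup>2 \<le> 1 / r"
        using assms by (simp add: power2_eq_square field_simps)
      then have "(r - 1) / 2 * (1 / r\<^sup>2) \<le> (r - 1) * (1 / r)"
        using assms by (intro mult_mono) auto
      also have "\<dots> = 1 - 1 / r"
        using r by (simp add: field_simps)
      also have "\<dots> \<le> ln r"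
        using ln_le_minus_one[of "1 / r"] r by (simp add: ln_div)
      finally show ?thesis by simp
    qed
    finally show "(1 + 1 / r\<^sup>2) powr ((r - 1) / 2) \<le> r"
      using r by simp
  qed simp
  finally have "r * y * (1 + y) powr (r - 1) \<le> r * y * (r * (1 + r\<^sup>2 * y\<^sup>2) powr ((r - 1) / 2))"
    using assms by (intro mult_left_mono) auto
  with tangent show ?thesis
    by (simp add: power2_eq_square mult_ac)
qed

text \<open>Both sides equal 1 at \<open>y = 0\<close>, and the derivative of their difference is
  \<open>p\<close> times the gap in \<open>one_plus_powr_growth\<close> for
  \<open>r = p - 1\<close>.\<close>

lemma one_plus_powr_taylor_bound:
  fixes p y :: real
  assumes p: "p \<ge> 2" and y: "y \<ge> 0"
  shows "(1 + y) powr p - p * y \<le> (1 + (p - 1)\<^sup>2 * y\<^sup>2) powr (p / 2)"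
proof -
  let ?h = "\<lambda>t::real. (1 + (p - 1)\<^sup>2 * t\<^sup>2) powr (p / 2) - (1 + t) powr p + p * t"
  have "?h 0 \<le> ?h y"
  proof (rule DERIV_nonneg_imp_nondecreasing[OF y])
    fix t :: real assume t: "0 \<le> t" "t \<le> y"
    have pos: "1 + (p - 1)\<^sup>2 * t\<^sup>2 > 0" by (simp add: add_pos_nonneg)
    have "(?h has_real_derivative p * ((p - 1)\<^sup>2 * t * (1 + (p - 1)\<^sup>2 * t\<^sup>2) powr ((p - 1 - 1) / 2)
        - ((1 + t) powr (p - 1) - 1))) (at t)"
      using t pos by (auto intro!: derivative_eq_intros simp: algebra_simps diff_divide_distrib)
    moreover have "0 \<le> p * ((p - 1)\<^sup>2 * t * (1 + (p - 1)\<^sup>2 * t\<^sup>2) powr ((p - 1 - 1) / 2)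
        - ((1 + t) powr (p - 1) - 1))"
      using one_plus_powr_growth[of "p - 1" t] p t by (intro mult_nonneg_nonneg) auto
    ultimately show "\<exists>d. DERIV ?h t :> d \<and> d \<ge> 0" by blast
  qed
  then show ?thesis by simp
qed

text \<open>The counterpart for increments of opposite sign. The difference of the two sides is
  shown to be nondecreasing first on [0, 1] and then beyond 1, since the absolute value changes
  branch at 1.\<close>

lemma one_minus_powr_taylor_bound:
  fixes p y :: real
  assumes p: "p \<ge> 2" and y: "y \<ge> 0"
  shows "\<bar>1 - y\<bar> powr p + p * y \<le> (1 + (p - 1)\<^sup>2 * y\<^sup>2) powr (p / 2)"
proof -
  define r where "r = p - 1"
  have r: "r \<ge> 1" "p = r + 1" using p by (auto simp: r_def)
  let ?B = "\<lambda>t::real. (1 + r\<^sup>2 * t\<^sup>2) powr (p / 2)"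
  let ?B' = "\<lambda>t::real. r\<^sup>2 * t * (1 + r\<^sup>2 * t\<^sup>2) powr ((r - 1) / 2)"
  have pos: "1 + r\<^sup>2 * t\<^sup>2 > 0" for t by (simp add: add_pos_nonneg)
  have rr: "r \<le> r\<^sup>2" using r by (simp add: power2_eq_square)
  have left: "\<bar>1 - z\<bar> powr p + p * z \<le> ?B z" if z: "0 \<le> z" "z \<le> 1" for z
  proof -
    let ?h = "\<lambda>t::real. ?B t - (1 - t) powr p - p * t"
    have "?h 0 \<le> ?h z"
    \<comment> \<open>The open-interval rule is used because the base \<open>1 - t\<close> may
      vanish at the endpoint \<open>t = 1\<close>; continuity covers the endpoints.\<close>
    proof (rule DERIV_nonneg_imp_increasing_open[OF z(1)])
      fix t assume t: "0 < t" "t < z"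
      have "(?h has_real_derivative p * (?B' t + (1 - t) powr r - 1)) (at t)"
        using t z pos[of t] by (auto intro!: derivative_eq_intros simp: r(2) algebra_simps add_divide_distrib diff_divide_distrib)
      moreover have "0 \<le> p * (?B' t + (1 - t) powr r - 1)"
      proof -
        \<comment> \<open>Bernoulli shows that \<open>(1 - t) powr r - 1\<close> is at least
          \<open>- r * t\<close>, which \<open>?B' t\<close> compensates because
          \<open>r \<le> r\<^sup>2\<close>.\<close>
        have "1 + r * (1 - t - 1) \<le> (1 - t) powr r"
          using r t z by (intro powr_Bernoulli) auto
        moreover have "r * t * 1 \<le> r\<^sup>2 * t * (1 + r\<^sup>2 * t\<^sup>2) powr ((r - 1) / 2)"
          using r t rr by (intro mult_mono ge_one_powr_ge_zero) auto
        ultimately show ?thesis using p by (intro mult_nonneg_nonneg) (auto simp: algebra_simps)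
      qed
      ultimately show "\<exists>d. DERIV ?h t :> d \<and> d \<ge> 0" by blast
    next
      show "continuous_on {0..z} ?h"
        using z p pos by (auto intro!: continuous_intros continuous_on_powr' simp: less_imp_neq[symmetric])
    qed
    then show ?thesis using z by simp
  qed
  show ?thesis
  proof (cases "y \<le> 1")
    case True
    then show ?thesis using left[of y] y by (simp add: r_def)
  next
    case False
    then have y1: "1 \<le> y" by simp
    let ?h = "\<lambda>t::real. ?B t - (t - 1) powr p - p * t"
    have "?h 1 \<le> ?h y"
    proof (rule DERIV_nonneg_imp_increasing_open[OF y1])
      fix t assume t: "1 < t" "t < y"
      have "(?h has_real_derivative p * (?B' t - (t - 1) powr r - 1)) (at t)"
        using t pos[of t] by (auto intro!: derivative_eq_intros simp: r(2) algebra_simps add_divide_distrib diff_divide_distrib)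
      moreover have "0 \<le> p * (?B' t - (t - 1) powr r - 1)"
      proof -
        have "1 = 1 powr (r - 1)" by simp
        also have "\<dots> \<le> t powr (r - 1)"
          using r t by (intro powr_mono2) auto
        finally have 1: "1 \<le> t powr (r - 1)" .
        \<comment> \<open>Splitting off one factor \<open>t - 1\<close> lets the remaining 1 be
          absorbed: \<open>(t - 1) * t powr (r - 1)\<close> plus 1 is at most
          \<open>t * t powr (r - 1)\<close>.\<close>
        have "(t - 1) powr r = (t - 1) * (t - 1) powr (r - 1)"
          using t by (simp add: powr_diff)
        also have "\<dots> \<le> (t - 1) * t powr (r - 1)"
          using r t by (intro mult_left_mono powr_mono2) auto
        finally have 2: "(t - 1) powr r + 1 \<le> t * t powr (r - 1)"
          using 1 by (simp add: algebra_simps)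
        have "t powr (r - 1) = (t\<^sup>2) powr ((r - 1) / 2)"
          using t by (simp add: power2_powr_half)
        also have "\<dots> \<le> (1 + r\<^sup>2 * t\<^sup>2) powr ((r - 1) / 2)"
        proof (intro powr_mono2)
          have "1 * t\<^sup>2 \<le> r\<^sup>2 * t\<^sup>2"
            using r by (intro mult_right_mono) (auto simp: one_le_power)
          then show "t\<^sup>2 \<le> 1 + r\<^sup>2 * t\<^sup>2" by simp
        qed (use r in auto)
        finally have "t * t powr (r - 1) \<le> (r\<^sup>2 * t) * (1 + r\<^sup>2 * t\<^sup>2) powr ((r - 1) / 2)"
          using r t rr by (intro mult_mono) (auto simp: one_le_power)
        with 2 show ?thesis using p by (intro mult_nonneg_nonneg) auto
      qed
      ultimately show "\<exists>d. DERIV ?h t :> d \<and> d \<ge> 0" by blast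
    next
      show "continuous_on {1..y} ?h"
        using p pos by (auto intro!: continuous_intros continuous_on_powr' simp: less_imp_neq[symmetric])
    qed
    \<comment> \<open>The first branch at 1 makes the starting value \<open>?h 1\<close>
      nonnegative.\<close>
    then show ?thesis using False left[of 1] p by (simp add: r_def)
  qed
qed

text \<open>Both sides are homogeneous of degree \<open>p\<close> in \<open>(s, x)\<close>, so for
  nonzero \<open>s\<close> division by \<open>s\<close> reduces the claim to \<open>s = 1\<close>,
  where the sign of \<open>z = x / s\<close> selects one of the two preceding bounds. For
  \<open>s = 0\<close> the linear term vanishes and \<open>(p - 1)\<^sup>2\<close> is at least
  1.\<close>

lemma abs_powr_taylor_bound:
  fixes p s x :: real
  assumes p: "p \<ge> 2"
  shows "\<bar>s + x\<bar> powr p \<le>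
    p * (sgn s * \<bar>s\<bar> powr (p - 1) * x) + (s\<^sup>2 + (p - 1)\<^sup>2 * x\<^sup>2) powr (p / 2)"
proof (cases "s = 0")
  case True
  have "\<bar>x\<bar> powr p = (x\<^sup>2) powr (p / 2)"
    by (simp add: power2_powr_half)
  also have "\<dots> \<le> ((p - 1)\<^sup>2 * x\<^sup>2) powr (p / 2)"
    using p mult_right_mono[of 1 "(p - 1)\<^sup>2" "x\<^sup>2"] by (intro powr_mono2) (auto simp: one_le_power)
  finally show ?thesis using True by simp
next
  case False
  define z where "z = x / s"
  have x: "x = s * z" using False by (simp add: z_def)
  have norm1: "\<bar>1 + z\<bar> powr p \<le> p * z + (1 + (p - 1)\<^sup>2 * z\<^sup>2) powr (p / 2)"
    using one_plus_powr_taylor_bound[of p z] one_minus_powr_taylor_bound[of p "- z"] p by (cases "z \<ge> 0") auto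
  have "\<bar>s + x\<bar> powr p = \<bar>s\<bar> powr p * \<bar>1 + z\<bar> powr p"
    unfolding powr_mult[symmetric] abs_mult[symmetric] by (simp add: x distrib_left)
  also have "\<dots> \<le> \<bar>s\<bar> powr p * (p * z + (1 + (p - 1)\<^sup>2 * z\<^sup>2) powr (p / 2))"
    using norm1 by (intro mult_left_mono) auto
  also have "\<dots> = p * (\<bar>s\<bar> powr p * z) + \<bar>s\<bar> powr p * (1 + (p - 1)\<^sup>2 * z\<^sup>2) powr (p / 2)"
    by (simp add: algebra_simps)
  also have "\<bar>s\<bar> powr p * z = sgn s * \<bar>s\<bar> powr (p - 1) * x"
    using False by (simp add: x powr_diff field_simps sgn_if abs_if)
  also have "\<bar>s\<bar> powr p = (s\<^sup>2) powr (p / 2)"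
    by (simp add: power2_powr_half)
  also have "(s\<^sup>2) powr (p / 2) * (1 + (p - 1)\<^sup>2 * z\<^sup>2) powr (p / 2)
      = (s\<^sup>2 + (p - 1)\<^sup>2 * x\<^sup>2) powr (p / 2)"
    by (simp add: x power_mult_distrib algebra_simps flip: powr_mult)
  finally show ?thesis .
qed


section \<open>Minkowski's inequality for nonnegative functions\<close>

text \<open>Convexity of the \<open>q\<close>-th power at the points \<open>w / u * a\<close> and
  \<open>w / v * b\<close> with weights \<open>u / w\<close> and \<open>v / w\<close>, where
  \<open>w = u + v\<close>. The weights stay free: the value 1 for both gives integrability of the
  sum, and the two norms give Minkowski.\<close>

lemma powr_add_le_weighted:
  fixes q a b u v :: real
  assumes q: "q \<ge> 1" and "a \<ge> 0" "b \<ge> 0" and uv: "u > 0" "v > 0"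
  shows "(a + b) powr q \<le> (u + v) powr (q - 1) * (u powr (1 - q) * a powr q + v powr (1 - q) * b powr q)"
proof -
  \<comment> \<open>Covers a vanishing summand; convexity is applied below to positive
    arguments.\<close>
  have single: "c powr q \<le> (u' + v') powr (q - 1) * (u' powr (1 - q) * c powr q)"
    if "u' > 0" "v' > 0" for c u' v' :: real
  proof -
    have "1 = u' powr (q - 1) * u' powr (1 - q)"
      using that by (simp flip: powr_add)
    also have "\<dots> \<le> (u' + v') powr (q - 1) * u' powr (1 - q)"
      using that q by (intro mult_right_mono powr_mono2) auto
    finally show ?thesis
      by (simp flip: mult.assoc add: mult_le_cancel_right1)
  qed
  consider "a = 0" | "b = 0" | "a > 0" "b > 0"
    using assms by fastforce
  then show ?thesis
  proof cases
    case 1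
    then show ?thesis using single[of v u b] uv q by (simp add: add.commute)
  next
    case 2
    then show ?thesis using single[of u v a] uv q by simp
  next
    case 3
    define w where "w = u + v"
    have w: "w > 0" "u / w \<ge> 0" "v / w \<ge> 0" "u / w + v / w = 1"
      using uv by (auto simp: w_def simp flip: add_divide_distrib)
    have "((u / w) *\<^sub>R (w / u * a) + (v / w) *\<^sub>R (w / v * b)) powr q
        \<le> u / w * (w / u * a) powr q + v / w * (w / v * b) powr q"
      using powr_convex[OF q, unfolded convex_on_def, THEN conjunct2, rule_format, of "w / u * a" "w / v * b" "u / w" "v / w"]
        w uv 3 by simp
    also have "(u / w) *\<^sub>R (w / u * a) + (v / w) *\<^sub>R (w / v * b) = a + b"
      using w uv by simp
    also have "u / w * (w / u * a) powr q + v / w * (w / v * b) powr q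
        = w powr (q - 1) * (u powr (1 - q) * a powr q + v powr (1 - q) * b powr q)"
    proof -
      have scale: "z / w * (w / z * c) powr q = w powr (q - 1) * (z powr (1 - q) * c powr q)"
        if "z > 0" for z c
        using w that unfolding powr_mult powr_divide powr_diff by (simp add: field_simps)
      show ?thesis unfolding scale[OF uv(1)] scale[OF uv(2)] by (simp add: distrib_left)
    qed
    finally show ?thesis by (simp add: w_def)
  qed
qed

text \<open>Integrating the weighted inequality with \<open>u\<close> and \<open>v\<close> equal to
  the norms of \<open>f\<close> and \<open>g\<close> makes its right side collapse to
  \<open>(u + v) powr q\<close>. The weights must be positive, so a function of norm zero is treated
  separately as vanishing almost everywhere.\<close>

lemma Minkowski_nonneg:
  fixes f g :: "'a \<Rightarrow> real" and q :: real
  assumes q: "q \<ge> 1"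
    and [measurable]: "f \<in> borel_measurable M" "g \<in> borel_measurable M"
    and nonneg: "\<And>w. f w \<ge> 0" "\<And>w. g w \<ge> 0"
    and int: "integrable M (\<lambda>w. f w powr q)" "integrable M (\<lambda>w. g w powr q)"
  shows "integrable M (\<lambda>w. (f w + g w) powr q)"
    and "(\<integral>w. (f w + g w) powr q \<partial>M) \<le>
      ((\<integral>w. f w powr q \<partial>M) powr (1 / q) + (\<integral>w. g w powr q \<partial>M) powr (1 / q)) powr q"
proof -
  have "integrable M (\<lambda>w. 2 powr (q - 1) * (f w powr q + g w powr q))"
    using int by auto
  then show int_sum: "integrable M (\<lambda>w. (f w + g w) powr q)"
  proof (rule Bochner_Integration.integrable_bound)
    show "AE w in M. norm ((f w + g w) powr q) \<le> norm (2 powr (q - 1) * (f w powr q + g w powr q))"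
      using powr_add_le_weighted[OF q nonneg, of 1 1] by simp
  qed simp
  define A where "A = (\<integral>w. f w powr q \<partial>M)"
  define B where "B = (\<integral>w. g w powr q \<partial>M)"
  have AB: "A \<ge> 0" "B \<ge> 0" by (auto simp: A_def B_def)
  have zero: "AE w in M. h w = 0"
    if "(\<integral>w. h w powr q \<partial>M) = 0" "integrable M (\<lambda>w. h w powr q)" for h :: "'a \<Rightarrow> real"
    using that integral_nonneg_eq_0_iff_AE[of M "\<lambda>w. h w powr q"] by auto
  consider "A = 0" | "B = 0" | "A > 0" "B > 0"
    using AB by fastforce
  then have "(\<integral>w. (f w + g w) powr q \<partial>M) \<le> (A powr (1 / q) + B powr (1 / q)) powr q"
  proof cases
    case 1
    then have "AE w in M. f w = 0" using zero int by (simp add: A_def)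
    then have "(\<integral>w. (f w + g w) powr q \<partial>M) = B"
      unfolding B_def by (intro integral_cong_AE) auto
    then show ?thesis using 1 AB q by (simp add: powr_powr)
  next
    case 2
    then have "AE w in M. g w = 0" using zero int by (simp add: B_def)
    then have "(\<integral>w. (f w + g w) powr q \<partial>M) = A"
      unfolding A_def by (intro integral_cong_AE) auto
    then show ?thesis using 2 AB q by (simp add: powr_powr)
  next
    case 3
    define u where "u = A powr (1 / q)"
    define v where "v = B powr (1 / q)"
    have uv: "u > 0" "v > 0" "u powr q = A" "v powr q = B"
      using 3 q by (auto simp: u_def v_def powr_powr)
    have "(\<integral>w. (f w + g w) powr q \<partial>M) \<le>
        (\<integral>w. (u + v) powr (q - 1) * (u powr (1 - q) * f w powr q + v powr (1 - q) * g w powr q) \<partial>M)"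
      using int int_sum uv by (intro integral_mono powr_add_le_weighted q nonneg) auto
    also have "\<dots> = (u + v) powr (q - 1) * (u powr (1 - q) * u powr q + v powr (1 - q) * v powr q)"
      using int uv by (simp add: A_def B_def)
    also have "\<dots> = (u + v) powr (q - 1) * (u + v) powr 1"
      using uv(1,2) by (simp flip: powr_add)
    also have "\<dots> = (u + v) powr q"
      using uv by (simp only: flip: powr_add) simp
    finally show ?thesis by (simp add: u_def v_def)
  qed
  then show "(\<integral>w. (f w + g w) powr q \<partial>M) \<le>
      ((\<integral>w. f w powr q \<partial>M) powr (1 / q) + (\<integral>w. g w powr q \<partial>M) powr (1 / q)) powr q"
    by (simp add: A_def B_def)
qed

section \<open>Moment bounds for martingale sums\<close>

lemma Lp_norm_powr:
  assumes "p > 0"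
  shows "Lp_norm M p f powr p = (\<integral>w. \<bar>f w\<bar> powr p \<partial>M)"
  using assms by (simp add: Lp_norm_def powr_powr)

lemma Lp_norm_nonneg: "Lp_norm M p f \<ge> 0"
  by (simp add: Lp_norm_def)

text \<open>The one-step estimate, a substitute for Pythagoras in \<open>L(p)\<close>, whose form
  for orthogonal increments it takes at \<open>p = 2\<close>. A squared \<open>L(p)\<close> norm is
  the \<open>L(p/2)\<close> norm of the square, so Minkowski applies with exponent
  \<open>p / 2 \<ge> 1\<close>.\<close>

lemma in_Lp_orthogonal_add:
  fixes S X :: "'a \<Rightarrow> real" and p :: real
  assumes "finite_measure_subalgebra M G" and p: "p \<ge> 2"
    and S: "in_Lp M p S" "S \<in> borel_measurable G" and X: "in_Lp M p X"
    and cond: "AE w in M. real_cond_exp M G X w = 0"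
  shows "in_Lp M p (\<lambda>w. S w + X w)"
    and "(Lp_norm M p (\<lambda>w. S w + X w))\<^sup>2 \<le> (Lp_norm M p S)\<^sup>2 + (p - 1)\<^sup>2 * (Lp_norm M p X)\<^sup>2"
proof -
  interpret finite_measure_subalgebra M G by fact
  note [measurable] = S(2)
  have meas [measurable]: "S \<in> borel_measurable M" "X \<in> borel_measurable M"
    and int: "integrable M (\<lambda>w. \<bar>S w\<bar> powr p)" "integrable M (\<lambda>w. \<bar>X w\<bar> powr p)"
    using S X by (auto simp: in_Lp_def)
  let ?D = "\<lambda>w. sgn (S w) * \<bar>S w\<bar> powr (p - 1)"
  let ?U = "\<lambda>w. (S w)\<^sup>2" and ?V = "\<lambda>w. (p - 1)\<^sup>2 * (X w)\<^sup>2"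
  have U: "?U w powr (p / 2) = \<bar>S w\<bar> powr p" for w
    by (simp add: power2_powr_half)
  have V: "?V w powr (p / 2) = (p - 1) powr p * \<bar>X w\<bar> powr p" for w
    using p by (simp add: power2_powr_half powr_mult)
  have int_D: "integrable M (\<lambda>w. ?D w * X w)"
  proof (rule Bochner_Integration.integrable_bound)
    show "integrable M (\<lambda>w. \<bar>S w\<bar> powr p + \<bar>X w\<bar> powr p)"
      using int by auto
    have "\<bar>s\<bar> powr (p - 1) * \<bar>x\<bar> \<le> \<bar>s\<bar> powr p + \<bar>x\<bar> powr p" for s x :: real
    proof -
      \<comment> \<open>A crude form of Young's inequality suffices, since only integrability is at
        stake.\<close>
      have "\<bar>s\<bar> powr (p - 1) * \<bar>x\<bar> \<le> max \<bar>s\<bar> \<bar>x\<bar> powr (p - 1) * max \<bar>s\<bar> \<bar>x\<bar>"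
        using p by (intro mult_mono powr_mono2) auto
      also have "\<dots> = max \<bar>s\<bar> \<bar>x\<bar> powr p"
        by (auto simp: powr_diff max_def)
      finally show ?thesis by (smt (verit) powr_ge_zero)
    qed
    then show "AE w in M. norm (?D w * X w) \<le> norm (\<bar>S w\<bar> powr p + \<bar>X w\<bar> powr p)"
      by (auto simp: abs_mult abs_sgn_eq)
  qed simp
  \<comment> \<open>Measurability with respect to \<open>G\<close> allows \<open>X\<close> to be
    replaced by its conditional expectation under the integral.\<close>
  have "?D \<in> borel_measurable G"
    by measurable
  then have "(\<integral>w. ?D w * X w \<partial>M) = (\<integral>w. ?D w * real_cond_exp M G X w \<partial>M)"
    using real_cond_exp_intg(2)[OF int_D] by simp
  also have "\<dots> = (\<integral>w. 0 \<partial>M)"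
    using cond by (intro integral_cong_AE) auto
  finally have orth: "(\<integral>w. ?D w * X w \<partial>M) = 0" by simp
  have int_UV: "integrable M (\<lambda>w. (?U w + ?V w) powr (p / 2))"
    and mink: "(\<integral>w. (?U w + ?V w) powr (p / 2) \<partial>M) \<le>
      ((\<integral>w. ?U w powr (p / 2) \<partial>M) powr (1 / (p / 2)) + (\<integral>w. ?V w powr (p / 2) \<partial>M) powr (1 / (p / 2))) powr (p / 2)"
    using p int by (intro Minkowski_nonneg[where f = ?U and g = ?V and q = "p / 2"]; simp add: U V)+
  have int_R: "integrable M (\<lambda>w. p * (?D w * X w) + (?U w + ?V w) powr (p / 2))"
    using int_D int_UV by (intro Bochner_Integration.integrable_add) auto
  \<comment> \<open>The right side of the pointwise inequality serves as integrable
    majorant.\<close>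
  have int_sum: "integrable M (\<lambda>w. \<bar>S w + X w\<bar> powr p)"
    by (rule Bochner_Integration.integrable_bound[OF int_R])
      (use abs_powr_taylor_bound[OF p] in \<open>auto intro: order_trans[OF _ abs_ge_self]\<close>)
  then show "in_Lp M p (\<lambda>w. S w + X w)"
    by (simp add: in_Lp_def)
  have sq: "c powr (1 / (p / 2)) = (c powr (1 / p))\<^sup>2" if "c \<ge> 0" for c :: real
    using that by (simp add: powr_powr flip: powr_numeral)
  have "(\<integral>w. \<bar>S w + X w\<bar> powr p \<partial>M) \<le> (\<integral>w. p * (?D w * X w) + (?U w + ?V w) powr (p / 2) \<partial>M)"
    using int_sum int_R abs_powr_taylor_bound[OF p] by (intro integral_mono) auto
  also have "\<dots> = (\<integral>w. (?U w + ?V w) powr (p / 2) \<partial>M)"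
    using int_D int_UV orth by simp
  also note mink
  also have "(\<integral>w. ?U w powr (p / 2) \<partial>M) powr (1 / (p / 2)) = (Lp_norm M p S)\<^sup>2"
    unfolding U by (subst sq) (auto simp: Lp_norm_def)
  also have "(\<integral>w. ?V w powr (p / 2) \<partial>M) powr (1 / (p / 2)) = (p - 1)\<^sup>2 * (Lp_norm M p X)\<^sup>2"
    unfolding V using p by (subst sq) (auto simp: Lp_norm_def powr_mult powr_powr power_mult_distrib)
  finally have "(\<integral>w. \<bar>S w + X w\<bar> powr p \<partial>M) powr (1 / (p / 2)) \<le>
      (((Lp_norm M p S)\<^sup>2 + (p - 1)\<^sup>2 * (Lp_norm M p X)\<^sup>2) powr (p / 2)) powr (1 / (p / 2))"
    using p by (intro powr_mono2) auto
  then show "(Lp_norm M p (\<lambda>w. S w + X w))\<^sup>2 \<le> (Lp_norm M p S)\<^sup>2 + (p - 1)\<^sup>2 * (Lp_norm M p X)\<^sup>2"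
    using p by (subst (asm) sq) (auto simp: Lp_norm_def powr_powr)
qed

text \<open>Induction on \<open>k \<le> n\<close>, adding \<open>\<xi> (Suc k)\<close> conditionally
  on \<open>F k\<close>. The invariant also carries \<open>F k\<close>-measurability of the partial
  sum, which the one-step estimate requires. Starting from the empty sum gives every increment the
  same factor \<open>(p - 1)\<^sup>2\<close>.\<close>

lemma martingale_partial_sum_Lp:
  fixes p :: real
  assumes "prob_space M" and F: "filtration_of M F" and p: "p \<ge> 2"
    and mart: "martingale_differences M F n \<xi>"
    and Lp: "\<And>i. i \<in> {1..n} \<Longrightarrow> in_Lp M p (\<xi> i)"
  shows "in_Lp M p (partial_sum \<xi> n) \<and>
    (Lp_norm M p (partial_sum \<xi> n))\<^sup>2 \<le> (p - 1)\<^sup>2 * (\<Sum>i=1..n. (Lp_norm M p (\<xi> i))\<^sup>2)"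
proof -
  interpret prob_space M by fact
  interpret filtration "space M" F using F by (simp add: filtration_of_def)
  have "partial_sum \<xi> k \<in> borel_measurable (F k) \<and> in_Lp M p (partial_sum \<xi> k) \<and>
    (Lp_norm M p (partial_sum \<xi> k))\<^sup>2 \<le> (p - 1)\<^sup>2 * (\<Sum>i=1..k. (Lp_norm M p (\<xi> i))\<^sup>2)"
    if "k \<le> n" for k
    using that
  proof (induction k)
    case 0
    have "partial_sum \<xi> 0 = (\<lambda>w. 0)" by (auto simp: partial_sum_def)
    then show ?case using p by (simp add: in_Lp_def Lp_norm_def)
  next
    case (Suc k)
    have eq: "partial_sum \<xi> (Suc k) = (\<lambda>w. partial_sum \<xi> k w + \<xi> (Suc k) w)"
      by (auto simp: partial_sum_def)
    have subalg: "subalgebra (F (Suc k)) (F k)"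
      using sets_F_mono[of k "Suc k"] by (simp add: subalgebra_def space_F)
    have "subalgebra M (F k)" using F by (simp add: filtration_of_def)
    then have G: "finite_measure_subalgebra M (F k)"
      by unfold_locales
    have X: "\<xi> (Suc k) \<in> borel_measurable (F (Suc k))" "in_Lp M p (\<xi> (Suc k))"
      "AE w in M. real_cond_exp M (F k) (\<xi> (Suc k)) w = 0"
      using mart Lp Suc.prems by (auto simp: martingale_differences_def)
    have IH: "partial_sum \<xi> k \<in> borel_measurable (F k)" "in_Lp M p (partial_sum \<xi> k)"
      "(Lp_norm M p (partial_sum \<xi> k))\<^sup>2 \<le> (p - 1)\<^sup>2 * (\<Sum>i=1..k. (Lp_norm M p (\<xi> i))\<^sup>2)"
      using Suc by auto
    note step = in_Lp_orthogonal_add[OF G p IH(2,1) X(2,3)]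
    show ?case
      using measurable_from_subalg[OF subalg IH(1)] X(1) step IH(3)
      by (auto simp: eq algebra_simps)
  qed
  then show ?thesis by blast
qed

section \<open>The tail bound, by Markov's inequality for the \<open>p\<close>-th absolute
  moment\<close>

theorem theorem2p2:
  fixes M :: "'a measure" and F :: "nat \<Rightarrow> 'a measure" and \<xi> :: "nat \<Rightarrow> 'a \<Rightarrow> real"
    and n :: nat and p x :: real
  assumes "prob_space M"
    and "filtration_of M F"
    and "p \<ge> 2"
    and "n \<ge> 1"
    and "martingale_differences M F n \<xi>"
    and "\<And>i. i \<in> {1..n} \<Longrightarrow> in_Lp M p (\<xi> i)"
    and "x \<ge> 1"
  shows "tail_prob M \<xi> n x \<le>
           x powr (- p) * (p - 1) powr p * real n powr (- p / 2) *
           (inverse (real n) * (\<Sum>i=1..n. (Lp_norm M p (\<xi> i))\<^sup>2)) powr (p / 2)"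
proof -
  interpret prob_space M by fact
  define S where "S = partial_sum \<xi> n"
  define T where "T = (\<Sum>i=1..n. (Lp_norm M p (\<xi> i))\<^sup>2)"
  have T: "T \<ge> 0" by (simp add: T_def sum_nonneg)
  have S: "S \<in> borel_measurable M" "integrable M (\<lambda>w. \<bar>S w\<bar> powr p)"
    and norm: "(Lp_norm M p S)\<^sup>2 \<le> (p - 1)\<^sup>2 * T"
    using martingale_partial_sum_Lp[OF assms(1,2,3,5,6)] by (auto simp: S_def T_def in_Lp_def)
  note [measurable] = S(1)
  have nx: "real n * x > 0" using assms by simp
  have "(\<integral>w. \<bar>S w\<bar> powr p \<partial>M) = ((Lp_norm M p S)\<^sup>2) powr (p / 2)"
    using assms(3) by (simp add: power2_powr_half Lp_norm_powr Lp_norm_nonneg)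
  also have "\<dots> \<le> ((p - 1)\<^sup>2 * T) powr (p / 2)"
    using norm assms(3) by (intro powr_mono2) auto
  also have "\<dots> = (p - 1) powr p * T powr (p / 2)"
    using assms(3) by (simp add: powr_mult power2_powr_half)
  finally have moment: "(\<integral>w. \<bar>S w\<bar> powr p \<partial>M) \<le> (p - 1) powr p * T powr (p / 2)" .
  have "tail_prob M \<xi> n x \<le> measure M {w \<in> space M. \<bar>S w\<bar> powr p \<ge> (real n * x) powr p}"
    unfolding tail_prob_def
  proof (intro finite_measure_mono)
    show "{w \<in> space M. partial_sum \<xi> n w / real n > x} \<subseteq> {w \<in> space M. \<bar>S w\<bar> powr p \<ge> (real n * x) powr p}"
      using assms nx by (auto simp: S_def field_simps intro!: powr_mono2)
  qed measurable
  also have "\<dots> \<le> (\<integral>w. \<bar>S w\<bar> powr p \<partial>M) / (real n * x) powr p"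
    using S assms by (intro integral_Markov_inequality_measure[where A = "{}"]) auto
  also have "\<dots> \<le> (p - 1) powr p * T powr (p / 2) / (real n * x) powr p"
    by (intro divide_right_mono moment) simp
  also have "\<dots> = x powr (- p) * (p - 1) powr p * real n powr (- p / 2) * (inverse (real n) * T) powr (p / 2)"
  proof -
    \<comment> \<open>Of the factor \<open>real n powr (- p)\<close> left by Markov, one half stays
      explicit and the other turns \<open>T\<close> into the average
      \<open>inverse (real n) * T\<close>.\<close>
    have "real n powr p = real n powr (p / 2) * real n powr (p / 2)"
      by (simp flip: powr_add)
    then show ?thesis
      using T by (simp add: powr_mult powr_minus powr_divide field_simps inverse_powr)
  qed
  finally show ?thesis by (simp add: T_def)
qed

end
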